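(* The map $\delta$ restricts to a bijection from the set of signed permutations $B_n$ to the set of centrally symmetric noncrossing arc diagrams on the $2n$ points $-n,\ldots,-1,1,\ldots,n$.
   Context: $B_n$ is the set of signed permutations of $\{\pm1,\ldots,\pm n\}$: bijections $\pi$ of this set with $\pi(-i)=-\pi(i)$; write $\pi_i=\pi(i)$, with long one-line notation $\pi_{-n}\cdots\pi_{-1}\pi_1\cdots\pi_n$. Place $2n$ points on a vertical line, labeled $-n,\ldots,-1,1,\ldots,n$ from bottom to top, positioned so that the half-turn $x\mapsto -x$ about the origin sends point $i$ to point $-i$. An arc is a curve from a labeled point $q$ to a strictly lower labeled point $p$, monotone downward, touching no other labeled point, passing to the left or right of each labeled point strictly between; arcs are considered up to combinatorial equivalence (same endpoints, same points on each side). Two arcs are compatible if they do not intersect except possibly at a common endpoint and do not share an upper endpoint or a lower endpoint. A noncrossing arc diagram is a set of pairwise compatible arcs (up to combinatorial equivalence); it is centrally symmetric if it is invariant under the half-turn. The map $\delta$ on permutations $\pi$ of $\{\pm1,\ldots,\pm n\}$ (positions ordered $-n<\cdots<-1<1<\cdots<n$): for each pair of consecutive positions $a$ (immediately before) $b$ with $\pi_a>\pi_b$, $\delta(\pi)$ contains an arc from $\pi_a$ down to $\pi_b$ passing to the right of every $\pi_c$ with $\pi_b<\pi_c<\pi_a$ and $c$ before $a$, and to the left of every such $\pi_c$ with $c$ after $b$; these are all its arcs. *)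

theory Defs
  imports "HOL-Analysis.Analysis" "HOL-Combinatorics.Permutations"
begin

definition labels :: "nat \<Rightarrow> int set" where
  "labels n = {- int n..int n} - {0}"

text \<open>\<open>permutes\<close> fixes the (irrelevant) values outside the label set, so that distinct
  functions are distinct signed permutations.\<close>

definition signed_permutations :: "nat \<Rightarrow> (int \<Rightarrow> int) set" where
  "signed_permutations n = {\<pi>. \<pi> permutes labels n \<and> (\<forall>i\<in>labels n. \<pi> (- i) = - \<pi> i)}"

definition consecutive :: "nat \<Rightarrow> int \<Rightarrow> int \<Rightarrow> bool" where
  "consecutive n a b \<longleftrightarrow>
     a \<in> labels n \<and> b \<in> labels n \<and> a < b \<and> (\<forall>c\<in>labels n. \<not> (a < c \<and> c < b))"

text \<open>The plane is the complex plane, and the point labeled \<open>i\<close> sits at height \<open>i\<close> on the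
  imaginary axis. The half-turn about the origin is then negation.\<close>

definition pt :: "int \<Rightarrow> complex" where
  "pt i = Complex 0 (of_int i)"

definition arcs :: "nat \<Rightarrow> (real \<Rightarrow> complex) set" where
  "arcs n = {\<gamma>. path \<gamma> \<and> strict_antimono_on {0..1} (\<lambda>t. Im (\<gamma> t)) \<and>
     (\<exists>q\<in>labels n. \<exists>p\<in>labels n. p < q \<and> pathstart \<gamma> = pt q \<and> pathfinish \<gamma> = pt p \<and>
        path_image \<gamma> \<inter> pt ` (labels n - {p, q}) = {})}"

text \<open>An arc \<open>\<gamma>\<close> passes to the left (right) of the point labeled \<open>i\<close> if, at the height of
  that point, it lies strictly to its left (right). For an arc this is never the case if \<open>i\<close>
  is not strictly between the labels of the endpoints.\<close>

definition passes_left :: "(real \<Rightarrow> complex) \<Rightarrow> int \<Rightarrow> bool" where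
  "passes_left \<gamma> i \<longleftrightarrow> (\<exists>z\<in>path_image \<gamma>. Im z = Im (pt i) \<and> Re z < Re (pt i))"

definition passes_right :: "(real \<Rightarrow> complex) \<Rightarrow> int \<Rightarrow> bool" where
  "passes_right \<gamma> i \<longleftrightarrow> (\<exists>z\<in>path_image \<gamma>. Im z = Im (pt i) \<and> Re z > Re (pt i))"

definition arc_equiv :: "nat \<Rightarrow> (real \<Rightarrow> complex) rel" where
  "arc_equiv n = {(\<gamma>, \<gamma>'). \<gamma> \<in> arcs n \<and> \<gamma>' \<in> arcs n \<and>
     pathstart \<gamma> = pathstart \<gamma>' \<and> pathfinish \<gamma> = pathfinish \<gamma>' \<and>
     (\<forall>i\<in>labels n. (passes_left \<gamma> i \<longleftrightarrow> passes_left \<gamma>' i) \<and>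
                    (passes_right \<gamma> i \<longleftrightarrow> passes_right \<gamma>' i))}"

definition compatible :: "(real \<Rightarrow> complex) \<Rightarrow> (real \<Rightarrow> complex) \<Rightarrow> bool" where
  "compatible \<gamma> \<gamma>' \<longleftrightarrow>
     path_image \<gamma> \<inter> path_image \<gamma>'
       \<subseteq> {pathstart \<gamma>, pathfinish \<gamma>} \<inter> {pathstart \<gamma>', pathfinish \<gamma>'} \<and>
     pathstart \<gamma> \<noteq> pathstart \<gamma>' \<and> pathfinish \<gamma> \<noteq> pathfinish \<gamma>'"

text \<open>A diagram is a set of equivalence classes of arcs which can be drawn simultaneously,
  that is, the set of classes of some set \<open>C\<close> of pairwise compatible curves.\<close>

definition noncrossing_arc_diagrams :: "nat \<Rightarrow> (real \<Rightarrow> complex) set set set" where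
  "noncrossing_arc_diagrams n =
     {D. \<exists>C\<subseteq>arcs n. pairwise compatible C \<and> D = C // arc_equiv n}"

text \<open>The path is reversed after the rotation so that it again runs downward.\<close>

definition half_turn :: "(real \<Rightarrow> complex) \<Rightarrow> real \<Rightarrow> complex" where
  "half_turn \<gamma> = reversepath (\<lambda>t. - \<gamma> t)"

definition centrally_symmetric :: "(real \<Rightarrow> complex) set set \<Rightarrow> bool" where
  "centrally_symmetric D \<longleftrightarrow> (\<lambda>A. half_turn ` A) ` D = D"

text \<open>Since \<open>a\<close> and \<open>b\<close> are consecutive, the conditions fix the side of every labeled point
  strictly between the endpoints, so each member of \<open>delta n \<pi>\<close> is a full equivalence class.\<close>

definition delta :: "nat \<Rightarrow> (int \<Rightarrow> int) \<Rightarrow> (real \<Rightarrow> complex) set set" where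
  "delta n \<pi> =
     {{\<gamma> \<in> arcs n. pathstart \<gamma> = pt (\<pi> a) \<and> pathfinish \<gamma> = pt (\<pi> b) \<and>
        (\<forall>c\<in>labels n. \<pi> b < \<pi> c \<and> \<pi> c < \<pi> a \<longrightarrow>
           (c < a \<longrightarrow> passes_right \<gamma> (\<pi> c)) \<and> (b < c \<longrightarrow> passes_left \<gamma> (\<pi> c)))}
      | a b. consecutive n a b \<and> \<pi> a > \<pi> b}"

end

(* Existence of a permutation with a given noncrossing arc diagram: process the labels from top to
   bottom. A label h is inserted immediately after the upper endpoint of the rightmost arc which is
   open at height h and weakly to the left of the point h (at the front if there is none). Since
   disjoint arcs keep their left-to-right order, the resulting word has exactly the arcs of the
   diagram as descents, with the correct sides. Conversely, the arcs of a permutation are drawn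
   simultaneously by shearing its plot.

   Injectivity: two permutations with the same image have the same inversions, by induction on the
   difference of the two values; if no intermediate value lies between them in the word, then the
   word descends past both of them in a single arc, whose sides tell their order.

   Finally, the half-turn of the diagram of pi is the diagram of i |-> - pi (- i), so that by
   injectivity the symmetric diagrams are exactly those of the signed permutations. *)

theory Submission
  imports Defs
begin

section \<open>Finite linear orders and insertion into the real line\<close>

lemma finite_labels [simp]: "finite (labels n)"
  by (simp add: labels_def)

lemma uminus_labels_iff [simp]: "- i \<in> labels n \<longleftrightarrow> i \<in> labels n"
  by (auto simp: labels_def)

text \<open>The maxima are matched and the rest follows by induction. It later turns a real-valued
  ordering of the labels into positions of a word.\<close>

lemma strict_mono_bij_exists:
  fixes A :: "'a::linorder set" and B :: "'b::linorder set"
  assumes "finite A" "finite B" "card A = card B"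
  shows "\<exists>g. bij_betw g A B \<and> strict_mono_on A g"
  using assms
proof (induction "card A" arbitrary: A B)
  case 0
  then show ?case by (auto simp: bij_betw_def strict_mono_on_def)
next
  case (Suc k)
  then have ne: "A \<noteq> {}" "B \<noteq> {}" by auto
  define a b where "a = Max A" and "b = Max B"
  have ab: "a \<in> A" "b \<in> B" using ne Suc.prems by (auto simp: a_def b_def)
  have la: "\<And>x. x \<in> A - {a} \<Longrightarrow> x < a"
    using Suc.prems by (auto simp: a_def less_le)
  have lb: "\<And>x. x \<in> B - {b} \<Longrightarrow> x < b"
    using Suc.prems by (auto simp: b_def less_le)
  obtain g where g: "bij_betw g (A - {a}) (B - {b})" "strict_mono_on (A - {a}) g"
    using Suc.hyps(1)[of "A - {a}" "B - {b}"] Suc.hyps(2) Suc.prems ab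
    by (metis card_Diff_singleton diff_Suc_1 finite_Diff)
  have "bij_betw (g(a := b)) (A - {a}) (B - {b})"
    using g(1) by (subst bij_betw_cong[of _ _ g]) auto
  then have "bij_betw (g(a := b)) (insert a (A - {a})) (insert b (B - {b}))"
    using notIn_Un_bij_betw[of a "A - {a}" "g(a:=b)" "B - {b}"] by simp
  then have bij: "bij_betw (g(a := b)) A B"
    using ab by (simp add: insert_absorb)
  have gb: "g x < b" if "x \<in> A - {a}" for x
    using lb[of "g x"] g(1) that by (meson bij_betwE)
  have "strict_mono_on A (g(a := b))"
  proof (rule strict_mono_onI)
    fix x y assume xy: "x \<in> A" "y \<in> A" "x < y"
    then have "x \<noteq> a" using la[of y] by force
    then show "(g(a := b)) x < (g(a := b)) y"
      using xy g(2) gb[of x] by (auto simp: strict_mono_on_def)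
  qed
  with bij show ?case by blast
qed

text \<open>Elements are placed on the real line in decreasing order, each immediately after its
  predecessor or in front of all others. Only \<open>r\<close> above \<open>h\<close> are
  constrained, being those already placed when \<open>h\<close> arrives; smaller elements may still
  come in between. Density of the reals always leaves room.\<close>

lemma sequential_insertion_exists:
  fixes L :: "'a::linorder set" and pred :: "'a \<Rightarrow> 'a option"
  assumes "finite L"
    and pred: "\<And>h q. h \<in> L \<Longrightarrow> pred h = Some q \<Longrightarrow> q \<in> L \<and> h < q"
  shows "\<exists>f :: 'a \<Rightarrow> real. inj_on f L \<and>
    (\<forall>h\<in>L. \<forall>r\<in>L. h < r \<longrightarrow>
      (case pred h of None \<Rightarrow> f h < f r | Some q \<Rightarrow> f q < f h \<and> \<not> (f q < f r \<and> f r < f h)))"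
  using assms
proof (induction L rule: finite_linorder_min_induct)
  case empty
  then show ?case by simp
next
  case (insert b A)
  have step: "q \<in> A \<and> h < q" if "h \<in> A" "pred h = Some q" for h q
    using insert.prems[of h q] insert.hyps(2) that by force
  then obtain f :: "'a \<Rightarrow> real" where f: "inj_on f A"
    "\<And>h r. h \<in> A \<Longrightarrow> r \<in> A \<Longrightarrow> h < r \<Longrightarrow>
      (case pred h of None \<Rightarrow> f h < f r | Some q \<Rightarrow> f q < f h \<and> \<not> (f q < f r \<and> f r < f h))"
  proof -
    have "\<exists>f :: 'a \<Rightarrow> real. inj_on f A \<and> (\<forall>h\<in>A. \<forall>r\<in>A. h < r \<longrightarrow>
      (case pred h of None \<Rightarrow> f h < f r | Some q \<Rightarrow> f q < f h \<and> \<not> (f q < f r \<and> f r < f h)))"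
      using step by (rule insert.IH)
    then show ?thesis using that by blast
  qed
  have bA: "b \<notin> A" using insert.hyps by auto
  have pA: "q \<in> A" if "h \<in> insert b A" "pred h = Some q" for h q
    using insert.prems[OF that] insert.hyps(2) that by force
  obtain x where x: "x \<notin> f ` A" "\<And>r. r \<in> A \<Longrightarrow>
     (case pred b of None \<Rightarrow> x < f r | Some q \<Rightarrow> f q < x \<and> \<not> (f q < f r \<and> f r < x))"
  proof (cases "pred b")
    case None
    \<comment> \<open>The added 0 keeps the minimum meaningful when \<open>A\<close> is
      empty.\<close>
    define x where "x = Min (insert 0 (f ` A)) - 1"
    have x: "x < f r" if "r \<in> A" for r
    proof -
      have "Min (insert 0 (f ` A)) \<le> f r"
        using that insert.hyps(1) by (intro Min_le) auto
      then show ?thesis by (simp add: x_def)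
    qed
    then have "x \<notin> f ` A" by force
    then show ?thesis using that[of x] None x by simp
  next
    case (Some q)
    \<comment> \<open>The added \<open>f q + 1\<close> keeps \<open>S\<close> nonempty when nothing
      lies after \<open>q\<close>. The midpoint of \<open>f q\<close> and \<open>Min S\<close> is
      then a free place directly after \<open>q\<close>.\<close>
    define S where "S = insert (f q + 1) {y \<in> f ` A. f q < y}"
    have S: "finite S" "S \<noteq> {}" "\<And>y. y \<in> S \<Longrightarrow> f q < y"
      using insert.hyps by (auto simp: S_def)
    then have m: "f q < Min S" by simp
    have m2: "Min S \<le> f r" if "r \<in> A" "f q < f r" for r
      using that by (intro Min_le S(1)) (simp add: S_def)
    define x where "x = (f q + Min S) / 2"
    have x: "f q < x" "x < Min S" using m by (auto simp: x_def)
    have nin: "\<not> (f q < f r \<and> f r \<le> x)" if "r \<in> A" for r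
      using m2[OF that] x by linarith
    show ?thesis
    proof (rule that[of x])
      show "x \<notin> f ` A" using nin x(1) by auto
      show "case pred b of None \<Rightarrow> x < f r | Some q \<Rightarrow> f q < x \<and> \<not> (f q < f r \<and> f r < x)"
        if "r \<in> A" for r
        using nin[OF that] x(1) less_imp_le[of "f r" x] by (auto simp: Some)
    qed
  qed
  have eq: "(f(b := x)) r = f r" if "r \<in> A" for r using that bA by auto
  show ?case
  proof (intro exI[of _ "f(b := x)"] conjI ballI impI)
    show "inj_on (f(b := x)) (insert b A)"
      using f(1) x(1) bA by (auto simp: inj_on_def)
    fix h r assume h: "h \<in> insert b A" and r: "r \<in> insert b A" "h < r"
    then have rA: "r \<in> A" using insert.hyps(2) by force
    show "case pred h of None \<Rightarrow> (f(b := x)) h < (f(b := x)) r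
      | Some q \<Rightarrow> (f(b := x)) q < (f(b := x)) h \<and>
          \<not> ((f(b := x)) q < (f(b := x)) r \<and> (f(b := x)) r < (f(b := x)) h)"
    proof (cases "h = b")
      case True
      then show ?thesis using x(2)[OF rA] pA[OF h] rA eq by (auto split: option.splits)
    next
      case False
      then have "h \<in> A" using h by simp
      then show ?thesis using f(2)[OF _ rA r(2)] pA[OF h] rA eq by (auto split: option.splits)
    qed
  qed
qed

section \<open>Reconstruction of a word from combinatorial arc data\<close>

text \<open>A noncrossing arc diagram seen combinatorially: \<open>T\<close> is the set of upper endpoints, the arc
  with upper endpoint \<open>q\<close> ends at \<open>bot q\<close> and has abscissa \<open>X q h\<close> at height \<open>h\<close>.\<close>

locale sweep =
  fixes L T :: "int set" and bot :: "int \<Rightarrow> int" and X :: "int \<Rightarrow> int \<Rightarrow> real"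
  assumes finite_L: "finite L"
    and T_sub: "T \<subseteq> L"
    and bot_in: "q \<in> T \<Longrightarrow> bot q \<in> L"
    and bot_less: "q \<in> T \<Longrightarrow> bot q < q"
    and bot_inj: "inj_on bot T"
    and X_top: "q \<in> T \<Longrightarrow> X q q = 0"
    and X_bot: "q \<in> T \<Longrightarrow> X q (bot q) = 0"
    and X_nz: "q \<in> T \<Longrightarrow> h \<in> L \<Longrightarrow> bot q < h \<Longrightarrow> h < q \<Longrightarrow> X q h \<noteq> 0"
    and X_order: "q \<in> T \<Longrightarrow> r \<in> T \<Longrightarrow> q \<noteq> r \<Longrightarrow>
      max (bot q) (bot r) \<le> h \<Longrightarrow> h \<le> min q r \<Longrightarrow>
      max (bot q) (bot r) \<le> h' \<Longrightarrow> h' \<le> min q r \<Longrightarrow> max (bot q) (bot r) < min q r \<Longrightarrow>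
      X q h < X r h \<Longrightarrow> X q h' < X r h'"
    and X_distinct: "q \<in> T \<Longrightarrow> r \<in> T \<Longrightarrow> q \<noteq> r \<Longrightarrow>
      max (bot q) (bot r) \<le> h \<Longrightarrow> h \<le> min q r \<Longrightarrow> max (bot q) (bot r) < min q r \<Longrightarrow>
      X q h \<noteq> X r h"
begin

definition left_arcs :: "int \<Rightarrow> int set" where
  "left_arcs h = {q \<in> T. bot q \<le> h \<and> h < q \<and> X q h \<le> 0}"

definition pred :: "int \<Rightarrow> int option" where
  "pred h = (if left_arcs h = {} then None else Some (ARG_MAX (\<lambda>q. X q h) q. q \<in> left_arcs h))"

lemma finite_left_arcs: "finite (left_arcs h)"
  using finite_L T_sub by (auto simp: left_arcs_def intro: finite_subset)

lemma pred_Some: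
  assumes "pred h = Some q"
  shows "q \<in> left_arcs h" "\<And>r. r \<in> left_arcs h \<Longrightarrow> X r h \<le> X q h"
proof -
  have ne: "left_arcs h \<noteq> {}" and q: "q = (ARG_MAX (\<lambda>q. X q h) q. q \<in> left_arcs h)"
    using assms by (auto simp: pred_def split: if_splits)
  then obtain m where "m \<in> left_arcs h" "\<And>r. r \<in> left_arcs h \<Longrightarrow> X r h \<le> X m h"
    using finite_left_arcs[of h] obtains_MAX[of "left_arcs h" "\<lambda>q. X q h"]
    by (metis (no_types, lifting) Max_ge finite_imageI image_eqI)
  then have "is_arg_max (\<lambda>q. X q h) (\<lambda>q. q \<in> left_arcs h) m"
    by (auto simp: is_arg_max_linorder)
  then have "is_arg_max (\<lambda>q. X q h) (\<lambda>q. q \<in> left_arcs h) q"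
    unfolding q arg_max_def by (rule someI)
  then show "q \<in> left_arcs h" "\<And>r. r \<in> left_arcs h \<Longrightarrow> X r h \<le> X q h"
    by (auto simp: is_arg_max_linorder)
qed

lemma pred_None: "pred h = None \<longleftrightarrow> left_arcs h = {}"
  by (simp add: pred_def)

text \<open>The arc ending at a label has abscissa 0 there, the largest value allowed in
  \<open>left_arcs\<close>. A competitor with abscissa 0 must also end there by \<open>X_nz\<close>,
  hence is the same arc by \<open>bot_inj\<close>.\<close>

lemma pred_bot:
  assumes "q \<in> T"
  shows "pred (bot q) = Some q"
proof -
  have q: "q \<in> left_arcs (bot q)"
    using assms bot_less X_bot by (simp add: left_arcs_def)
  then obtain s where s: "pred (bot q) = Some s"
    using pred_None by fastforce
  then have "s \<in> T" "bot s \<le> bot q" "bot q < s" "X s (bot q) \<ge> 0" "X s (bot q) \<le> 0"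
    using pred_Some[OF s] q assms X_bot by (force simp: left_arcs_def)+
  then have "bot s = bot q"
    using X_nz[of s "bot q"] bot_in[OF assms] by force
  then have "s = q"
    using bot_inj \<open>s \<in> T\<close> assms by (auto dest: inj_onD)
  with s show ?thesis by simp
qed

end

text \<open>\<open>f\<close> is the word order produced by insertion, held fixed while its descents
  are identified. \<open>sweep_order_exists\<close> supplies it.\<close>

locale sweep_order = sweep +
  fixes f :: "int \<Rightarrow> real"
  assumes f_inj: "inj_on f L"
    and f_None: "h \<in> L \<Longrightarrow> r \<in> L \<Longrightarrow> h < r \<Longrightarrow> pred h = None \<Longrightarrow> f h < f r"
    and f_Some: "h \<in> L \<Longrightarrow> r \<in> L \<Longrightarrow> h < r \<Longrightarrow> pred h = Some q \<Longrightarrow>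
      f q < f h \<and> \<not> (f q < f r \<and> f r < f h)"
begin

lemma f_pred: "h \<in> L \<Longrightarrow> pred h = Some q \<Longrightarrow> q \<in> L \<and> h < q \<and> f q < f h"
  using f_Some[of h q q] pred_Some(1)[of h q] T_sub by (auto simp: left_arcs_def)

text \<open>Induction from the top height downward. The upper endpoints of the arcs open at
  \<open>h\<close> appear in the word in the left-to-right order of these arcs, so inserting
  \<open>h\<close> after the rightmost one weakly to its left puts it on the correct side of all of
  them.\<close>

lemma side:
  assumes "q \<in> T" "h \<in> L" "bot q < h" "h < q"
  shows "(X q h < 0 \<longrightarrow> f q < f h) \<and> (X q h > 0 \<longrightarrow> f h < f q)"
  using assms
proof (induction "nat (Max L - h)" arbitrary: q h rule: less_induct)
  case less
  have qL: "q \<in> L" using less.prems T_sub by auto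
  \<comment> \<open>At the lower of the two upper endpoints one arc has abscissa 0. Since the order
    of the arcs is the same there as at \<open>h\<close>, the other arc passes that endpoint on a
    known side, and the induction hypothesis applies.\<close>
  have cmp: "f s < f r" if "s \<in> T" "r \<in> T" "bot s \<le> h" "bot r \<le> h" "h < s" "h < r" "X s h < X r h" for s r
  proof (cases s r rule: linorder_cases)
    case less' : less
    have s: "s \<in> L" "s \<le> Max L" using that T_sub finite_L by auto
    have "X s s < X r s"
      using X_order[of s r h s] that less' by auto
    then show ?thesis
      using less.hyps[of s r] that less' s X_top by auto
  next
    case equal
    then show ?thesis using that by simp
  next
    case greater
    have r: "r \<in> L" "r \<le> Max L" using that T_sub finite_L by auto
    have "X s r < X r r"
      using X_order[of s r h r] that greater by auto
    then show ?thesis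
      using less.hyps[of r s] that greater r X_top by auto
  qed
  show ?case
  proof (intro conjI impI)
    assume neg: "X q h < 0"
    then have q: "q \<in> left_arcs h" using less.prems by (simp add: left_arcs_def)
    then obtain s where s: "pred h = Some s"
      using pred_None by fastforce
    have sT: "s \<in> T" "bot s \<le> h" "h < s" "X q h \<le> X s h"
      using pred_Some[OF s] q by (auto simp: left_arcs_def)
    have "f q \<le> f s"
    proof (cases "q = s")
      case False
      then have "X q h \<noteq> X s h"
        using X_distinct[of q s h] sT less.prems by auto
      then show ?thesis using cmp[of q s] sT less.prems by auto
    qed simp
    then show "f q < f h" using f_pred[OF less.prems(2) s] by simp
  next
    assume pos: "X q h > 0"
    show "f h < f q"
    proof (cases "pred h")
      case None
      then show ?thesis using f_None less.prems qL by blast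
    next
      case (Some s)
      have sT: "s \<in> T" "bot s \<le> h" "h < s" "X s h \<le> 0"
        using pred_Some(1)[OF Some] by (auto simp: left_arcs_def)
      \<comment> \<open>Thus \<open>q\<close> was already placed after \<open>s\<close>, and
        \<open>h\<close>, inserted immediately after \<open>s\<close>, must precede it.\<close>
      have "f s < f q" using cmp[of s q] sT pos less.prems by auto
      moreover have "f h \<noteq> f q"
        using f_inj less.prems qL by (auto dest: inj_onD)
      ultimately show ?thesis using f_Some[OF less.prems(2) qL _ Some] less.prems by force
    qed
  qed
qed

text \<open>In a descent the smaller label was inserted later, hence directly after the larger one.
  Conversely, \<open>bot a\<close> is inserted directly after \<open>a\<close>, and no lower label
  can be inserted between them because the arc of \<open>a\<close> is no longer open.\<close>

lemma descent_iff_arc: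
  assumes ab: "a \<in> L" "b \<in> L"
  shows "f a < f b \<and> (\<forall>c\<in>L. \<not> (f a < f c \<and> f c < f b)) \<and> b < a \<longleftrightarrow> a \<in> T \<and> bot a = b"
proof
  assume *: "f a < f b \<and> (\<forall>c\<in>L. \<not> (f a < f c \<and> f c < f b)) \<and> b < a"
  then obtain s where s: "pred b = Some s"
    using f_None[OF ab(2,1)] by (cases "pred b") auto
  have "s = a"
    using * f_pred[OF ab(2) s] f_Some[OF ab(2,1) _ s] f_inj ab(1)
    by (metis inj_onD linorder_neqE_linordered_idom)
  then have a: "a \<in> T" "bot a \<le> b"
    using pred_Some(1)[OF s] by (auto simp: left_arcs_def)
  \<comment> \<open>If the arc of \<open>a\<close> continued below \<open>b\<close>, its lower
    endpoint would later be inserted directly after \<open>a\<close> and separate \<open>a\<close>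
    from \<open>b\<close>.\<close>
  have "bot a = b"
  proof (rule ccontr)
    assume "bot a \<noteq> b"
    then have "\<not> (f a < f b \<and> f b < f (bot a))" "f a < f (bot a)"
      using f_Some[OF bot_in[OF a(1)] ab(2) _ pred_bot[OF a(1)]] a by auto
    moreover have "f b \<noteq> f (bot a)"
      using f_inj ab bot_in[OF a(1)] \<open>bot a \<noteq> b\<close> by (auto dest: inj_onD)
    ultimately show False using * bot_in[OF a(1)] by force
  qed
  with a show "a \<in> T \<and> bot a = b" by simp
next
  assume *: "a \<in> T \<and> bot a = b"
  then have pb: "pred b = Some a" and ba: "b < a" using pred_bot bot_less by auto
  have fab: "f a < f b" using f_pred[OF ab(2) pb] by simp
  define B where "B = {c \<in> L. f a < f c \<and> f c < f b}"
  have lt: "c < b" if "c \<in> B" for c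
    using that f_Some[OF ab(2) _ _ pb, of c] by (cases c b rule: linorder_cases) (auto simp: B_def)
  have "B = {}"
  proof (rule ccontr)
    assume ne: "B \<noteq> {}"
    have finB: "finite B" using finite_L by (auto simp: B_def)
    \<comment> \<open>The highest intruder was the first to be inserted, so its predecessor can only
      be \<open>a\<close>. Then the arc of \<open>a\<close> would reach down to \<open>r\<close>,
      below its own endpoint \<open>b\<close>.\<close>
    define r where "r = Max B"
    have r: "r \<in> B" "\<And>c. c \<in> B \<Longrightarrow> c \<le> r" using ne finB by (auto simp: r_def)
    then have rL: "r \<in> L" "r < a" using lt[of r] ba by (auto simp: B_def)
    obtain s where s: "pred r = Some s"
      using f_None[OF rL(1) ab(1) rL(2)] r(1) by (cases "pred r") (auto simp: B_def)
    have s': "s \<in> L" "r < s" "f s < f r" using f_pred[OF rL(1) s] by auto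
    have "\<not> f s < f a" using f_Some[OF rL(1) ab(1) rL(2) s] r(1) by (auto simp: B_def)
    moreover have "s \<notin> B" using r(2)[of s] s' by auto
    ultimately have "f s = f a" using s' r(1) by (force simp: B_def)
    then have "s = a" using f_inj s' ab by (auto dest: inj_onD)
    then have "bot a \<le> r" using pred_Some(1)[OF s] by (simp add: left_arcs_def)
    then show False using lt[OF r(1)] * by simp
  qed
  then show "f a < f b \<and> (\<forall>c\<in>L. \<not> (f a < f c \<and> f c < f b)) \<and> b < a"
    using fab ba by (auto simp: B_def)
qed

end

lemma (in sweep) sweep_order_exists: "\<exists>f. sweep_order L T bot X f"
proof -
  have "q \<in> L \<and> h < q" if "pred h = Some q" for h q
    using pred_Some(1)[OF that] T_sub by (auto simp: left_arcs_def)
  then obtain f :: "int \<Rightarrow> real" where "inj_on f L"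
    "\<And>h r. h \<in> L \<Longrightarrow> r \<in> L \<Longrightarrow> h < r \<Longrightarrow>
      (case pred h of None \<Rightarrow> f h < f r | Some q \<Rightarrow> f q < f h \<and> \<not> (f q < f r \<and> f r < f h))"
    using sequential_insertion_exists[OF finite_L, of pred] by blast
  note f = this
  have "sweep_order L T bot X f"
  proof unfold_locales
    show "inj_on f L" by (fact f)
    show "f h < f r" if "h \<in> L" "r \<in> L" "h < r" "pred h = None" for h r
      using f(2)[OF that(1-3)] that(4) by simp
    show "f q < f h \<and> \<not> (f q < f r \<and> f r < f h)"
      if "h \<in> L" "r \<in> L" "h < r" "pred h = Some q" for h r q
      using f(2)[OF that(1-3)] that(4) by simp
  qed
  then show ?thesis by blast
qed

text \<open>Positions are labels as well, so \<pi> lists the labels by increasing \<open>f\<close>.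
  Consecutive positions become \<open>f\<close>-adjacent labels, to which
  \<open>descent_iff_arc\<close> and \<open>side\<close> apply.\<close>

lemma (in sweep) permutation_exists:
  assumes "L = labels n"
  obtains \<pi> where "\<pi> permutes labels n"
    "\<And>a b. consecutive n a b \<Longrightarrow> \<pi> b < \<pi> a \<longleftrightarrow> \<pi> a \<in> T \<and> bot (\<pi> a) = \<pi> b"
    "\<And>q. q \<in> T \<Longrightarrow> \<exists>a b. consecutive n a b \<and> \<pi> a = q \<and> \<pi> b = bot q"
    "\<And>a c. a \<in> labels n \<Longrightarrow> c \<in> labels n \<Longrightarrow> \<pi> a \<in> T \<Longrightarrow> bot (\<pi> a) < \<pi> c \<Longrightarrow> \<pi> c < \<pi> a \<Longrightarrow>
       (if c < a then X (\<pi> a) (\<pi> c) > 0 else X (\<pi> a) (\<pi> c) < 0)"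
proof -
  obtain f where "sweep_order L T bot X f" using sweep_order_exists by blast
  then interpret sweep_order L T bot X f .
  have fin: "finite (labels n)" by simp
  \<comment> \<open>\<open>g\<close> gives the \<open>f\<close>-value of the label that is to stand
    at each position.\<close>
  obtain g where g: "bij_betw g (labels n) (f ` labels n)" "strict_mono_on (labels n) g"
    using strict_mono_bij_exists[OF fin, of "f ` labels n"] f_inj
    unfolding assms by (metis card_image fin finite_imageI)
  define \<pi> where "\<pi> = (\<lambda>i. if i \<in> labels n then inv_into (labels n) f (g i) else i)"
  have f\<pi>: "f (\<pi> i) = g i" if "i \<in> labels n" for i
    using that g(1) by (auto simp: \<pi>_def bij_betw_def intro!: f_inv_into_f)
  have "bij_betw (inv_into (labels n) f) (f ` labels n) (labels n)"
    using f_inj unfolding assms by (simp add: bij_betw_inv_into bij_betw_imageI)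
  with g(1) have "bij_betw (inv_into (labels n) f \<circ> g) (labels n) (labels n)"
    by (rule bij_betw_trans)
  then have "bij_betw \<pi> (labels n) (labels n)"
    by (subst bij_betw_cong[of _ _ "inv_into (labels n) f \<circ> g"]) (auto simp: \<pi>_def)
  then have perm: "\<pi> permutes labels n"
    by (intro bij_imp_permutes) (auto simp: \<pi>_def)
  have mono: "f (\<pi> i) < f (\<pi> j) \<longleftrightarrow> i < j" if "i \<in> labels n" "j \<in> labels n" for i j
    using that g(2) by (simp add: f\<pi> strict_mono_on_less)
  have in_L: "\<pi> i \<in> L \<longleftrightarrow> i \<in> labels n" for i
    using perm by (simp add: assms permutes_in_image)
  have cons: "consecutive n a b \<longleftrightarrow> f (\<pi> a) < f (\<pi> b) \<and> (\<forall>c\<in>L. \<not> (f (\<pi> a) < f c \<and> f c < f (\<pi> b)))"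
    if "a \<in> labels n" "b \<in> labels n" for a b
  proof -
    have "(\<forall>c\<in>\<pi> ` labels n. \<not> (f (\<pi> a) < f c \<and> f c < f (\<pi> b))) \<longleftrightarrow> (\<forall>c\<in>labels n. \<not> (a < c \<and> c < b))"
      using that by (simp add: mono)
    then show ?thesis
      using that perm by (simp add: consecutive_def mono assms permutes_image)
  qed
  have desc: "consecutive n a b \<and> \<pi> b < \<pi> a \<longleftrightarrow> \<pi> a \<in> T \<and> bot (\<pi> a) = \<pi> b"
    if "a \<in> labels n" "b \<in> labels n" for a b
    using descent_iff_arc[of "\<pi> a" "\<pi> b"] that by (auto simp: in_L cons)
  show ?thesis
  proof (rule that[OF perm])
    show "\<pi> b < \<pi> a \<longleftrightarrow> \<pi> a \<in> T \<and> bot (\<pi> a) = \<pi> b" if "consecutive n a b" for a b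
      using desc[of a b] that by (auto simp: consecutive_def)
    show "\<exists>a b. consecutive n a b \<and> \<pi> a = q \<and> \<pi> b = bot q" if q: "q \<in> T" for q
    proof -
      have "q \<in> labels n" "bot q \<in> labels n" using q T_sub bot_in assms by auto
      then obtain a b where "a \<in> labels n" "b \<in> labels n" "\<pi> a = q" "\<pi> b = bot q"
        using permutes_image[OF perm] by (metis imageE)
      then show ?thesis using desc q by metis
    qed
    show "if c < a then X (\<pi> a) (\<pi> c) > 0 else X (\<pi> a) (\<pi> c) < 0"
      if "a \<in> labels n" "c \<in> labels n" "\<pi> a \<in> T" "bot (\<pi> a) < \<pi> c" "\<pi> c < \<pi> a" for a c
      using side[of "\<pi> a" "\<pi> c"] X_nz[of "\<pi> a" "\<pi> c"] that mono[of c a] mono[of a c] by (auto simp: in_L)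
  qed
qed

section \<open>Arcs as graphs over their height\<close>

text \<open>The height is continuous and injective on the compact interval \<open>{0..1}\<close>, so
  it has a continuous inverse, and the curve can be reparametrized by height.\<close>

lemma arc_graph:
  assumes "path \<gamma>" "strict_antimono_on {0..1} (\<lambda>t. Im (\<gamma> t))"
  obtains X where "continuous_on {Im (pathfinish \<gamma>)..Im (pathstart \<gamma>)} X"
    "path_image \<gamma> = (\<lambda>y. Complex (X y) y) ` {Im (pathfinish \<gamma>)..Im (pathstart \<gamma>)}"
proof -
  let ?Y = "{Im (pathfinish \<gamma>)..Im (pathstart \<gamma>)}"
  define h where "h = (\<lambda>t. Im (\<gamma> t))"
  have cont: "continuous_on {0..1} h"
    using assms(1) unfolding h_def path_def by (intro continuous_intros)
  have anti: "h t < h s" if "s \<in> {0..1}" "t \<in> {0..1}" "s < t" for s t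
    using assms(2) that by (auto simp: h_def monotone_on_def)
  then have inj: "inj_on h {0..1}"
    by (intro linorder_inj_onI') (metis less_irrefl)
  have im: "h ` {0..1} = ?Y"
  proof
    have "h t \<in> ?Y" if "t \<in> {0..1}" for t
      using anti[of 0 t] anti[of t 1] that
      by (cases "t = 0"; cases "t = 1") (auto simp: h_def pathstart_def pathfinish_def)
    then show "h ` {0..1} \<subseteq> ?Y" by blast
    have "\<exists>t\<ge>0. t \<le> 1 \<and> h t = y" if "y \<in> ?Y" for y
      using that cont by (intro IVT2') (auto simp: h_def pathstart_def pathfinish_def)
    then show "?Y \<subseteq> h ` {0..1}" by fastforce
  qed
  define g where "g = the_inv_into {0..1} h"
  have gh: "g (h t) = t" if "t \<in> {0..1}" for t
    using inj that by (simp add: g_def the_inv_into_f_f)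
  have contg: "continuous_on ?Y g"
    unfolding im[symmetric] using gh by (intro continuous_on_inv[OF cont]) auto
  have gY: "g ` ?Y \<subseteq> {0..1}"
    unfolding im[symmetric] using gh by auto
  have "continuous_on ?Y (\<lambda>y. Re (\<gamma> (g y)))"
    using continuous_on_compose2[OF assms(1)[unfolded path_def] contg gY]
    by (rule continuous_on_Re)
  moreover have "path_image \<gamma> = (\<lambda>y. Complex (Re (\<gamma> (g y))) y) ` ?Y"
  proof -
    have "Complex (Re (\<gamma> (g (h t)))) (h t) = \<gamma> t" if "t \<in> {0..1}" for t
      using gh[OF that] by (simp add: h_def)
    then have "(\<lambda>y. Complex (Re (\<gamma> (g y))) y) ` h ` {0..1} = \<gamma> ` {0..1}"
      unfolding image_image by (intro image_cong) auto
    then show ?thesis by (simp add: im path_image_def)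
  qed
  ultimately show ?thesis by (rule that)
qed

lemma pt_simps [simp]: "Re (pt i) = 0" "Im (pt i) = of_int i" "pt i = pt j \<longleftrightarrow> i = j" "pt (- i) = - pt i"
  by (auto simp: pt_def complex_eq_iff)

lemma passes_graph:
  assumes "path_image \<gamma> = (\<lambda>y. Complex (X y) y) ` {of_int p..of_int q}" "p \<le> i" "i \<le> q"
  shows "passes_left \<gamma> i \<longleftrightarrow> X (of_int i) < 0" "passes_right \<gamma> i \<longleftrightarrow> X (of_int i) > 0"
  using assms by (auto simp: passes_left_def passes_right_def)

lemma arcsE:
  assumes "\<gamma> \<in> arcs n"
  obtains p q X where "p \<in> labels n" "q \<in> labels n" "p < q" "pathstart \<gamma> = pt q" "pathfinish \<gamma> = pt p"
    "continuous_on {of_int p..of_int q} X"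
    "path_image \<gamma> = (\<lambda>y. Complex (X y) y) ` {of_int p..of_int q}"
    "X p = 0" "X q = 0" "\<And>i. i \<in> labels n \<Longrightarrow> p < i \<Longrightarrow> i < q \<Longrightarrow> X i \<noteq> 0"
proof -
  obtain p q where *: "path \<gamma>" "strict_antimono_on {0..1} (\<lambda>t. Im (\<gamma> t))"
    "p \<in> labels n" "q \<in> labels n" "p < q" "pathstart \<gamma> = pt q" "pathfinish \<gamma> = pt p"
    "path_image \<gamma> \<inter> pt ` (labels n - {p, q}) = {}"
    using assms by (auto simp: arcs_def)
  obtain X where X: "continuous_on {real_of_int p..real_of_int q} X"
    "path_image \<gamma> = (\<lambda>y. Complex (X y) y) ` {real_of_int p..real_of_int q}"
    using arc_graph[OF *(1,2)] * by auto
  have "pt q \<in> path_image \<gamma>" "pt p \<in> path_image \<gamma>"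
    using * pathstart_in_path_image[of \<gamma>] pathfinish_in_path_image[of \<gamma>] by simp_all
  then have "X p = 0" "X q = 0"
    by (auto simp: X(2) pt_def)
  moreover have "X i \<noteq> 0" if "i \<in> labels n" "p < i" "i < q" for i
  proof
    assume "X i = 0"
    then have "pt i \<in> path_image \<gamma>"
      using that by (force simp: X(2) pt_def)
    then show False using *(8) that by auto
  qed
  ultimately show ?thesis using that[OF *(3-7) X] by simp
qed

text \<open>There is exactly one point of the arc at each height in its range, and it avoids the
  labels strictly inside. Hence the two sides are complementary there and both fail
  elsewhere.\<close>

lemma passes_between:
  assumes "\<gamma> \<in> arcs n" "pathstart \<gamma> = pt q" "pathfinish \<gamma> = pt p" "i \<in> labels n"
  shows "passes_left \<gamma> i \<longleftrightarrow> p < i \<and> i < q \<and> \<not> passes_right \<gamma> i"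
    and "passes_right \<gamma> i \<longleftrightarrow> p < i \<and> i < q \<and> \<not> passes_left \<gamma> i"
proof -
  obtain X where X: "path_image \<gamma> = (\<lambda>y. Complex (X y) y) ` {real_of_int p..real_of_int q}"
    "X p = 0" "X q = 0" "\<And>i. i \<in> labels n \<Longrightarrow> p < i \<Longrightarrow> i < q \<Longrightarrow> X i \<noteq> 0"
  proof (rule arcsE[OF assms(1)], goal_cases)
    case (1 p' q' X)
    then have "p' = p" "q' = q" using assms(2,3) by simp_all
    with 1 show ?case by blast
  qed
  have out: "\<not> passes_left \<gamma> i \<and> \<not> passes_right \<gamma> i" if "i < p \<or> q < i"
    using that by (auto simp: passes_left_def passes_right_def X(1))
  consider "i < p \<or> q < i" | "i = p \<or> i = q" "p \<le> i" "i \<le> q" | "p < i" "i < q" by linarith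
  then have "passes_left \<gamma> i \<and> \<not> passes_right \<gamma> i \<and> p < i \<and> i < q \<or>
    passes_right \<gamma> i \<and> \<not> passes_left \<gamma> i \<and> p < i \<and> i < q \<or>
    \<not> passes_left \<gamma> i \<and> \<not> passes_right \<gamma> i \<and> \<not> (p < i \<and> i < q)"
  proof cases
    case 1
    then show ?thesis using out by auto
  next
    case 2
    then show ?thesis using passes_graph[OF X(1), of i] X(2,3) by auto
  next
    case 3
    then show ?thesis using passes_graph[OF X(1), of i] X(4)[of i] assms(4) by auto
  qed
  then show "passes_left \<gamma> i \<longleftrightarrow> p < i \<and> i < q \<and> \<not> passes_right \<gamma> i"
    "passes_right \<gamma> i \<longleftrightarrow> p < i \<and> i < q \<and> \<not> passes_left \<gamma> i"
    by blast+
qed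

section \<open>Members of \<open>delta\<close> as equivalence classes\<close>

definition delta_class :: "nat \<Rightarrow> (int \<Rightarrow> int) \<Rightarrow> int \<Rightarrow> int \<Rightarrow> (real \<Rightarrow> complex) set" where
  "delta_class n \<pi> a b = {\<gamma> \<in> arcs n. pathstart \<gamma> = pt (\<pi> a) \<and> pathfinish \<gamma> = pt (\<pi> b) \<and>
        (\<forall>c\<in>labels n. \<pi> b < \<pi> c \<and> \<pi> c < \<pi> a \<longrightarrow>
           (c < a \<longrightarrow> passes_right \<gamma> (\<pi> c)) \<and> (b < c \<longrightarrow> passes_left \<gamma> (\<pi> c)))}"

lemma delta_eq: "delta n \<pi> = {delta_class n \<pi> a b | a b. consecutive n a b \<and> \<pi> a > \<pi> b}"
  unfolding delta_def delta_class_def ..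

lemma consecutive_cases:
  assumes "consecutive n a b" "c \<in> labels n"
  shows "c < a \<or> c = a \<or> c = b \<or> b < c"
proof -
  have "\<not> (a < c \<and> c < b)" using assms by (simp add: consecutive_def)
  then show ?thesis by linarith
qed

text \<open>Every position other than \<open>a\<close> and \<open>b\<close> lies before
  \<open>a\<close> or after \<open>b\<close>, so one implication of the definition applies, and
  \<open>passes_between\<close> upgrades it to an equivalence.\<close>

lemma delta_class_passes:
  assumes "\<pi> permutes labels n" "consecutive n a b" "\<gamma> \<in> delta_class n \<pi> a b" "c \<in> labels n"
  shows "passes_right \<gamma> (\<pi> c) \<longleftrightarrow> \<pi> b < \<pi> c \<and> \<pi> c < \<pi> a \<and> c < a"
    and "passes_left \<gamma> (\<pi> c) \<longleftrightarrow> \<pi> b < \<pi> c \<and> \<pi> c < \<pi> a \<and> b < c"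
proof -
  have \<gamma>: "\<gamma> \<in> arcs n" "pathstart \<gamma> = pt (\<pi> a)" "pathfinish \<gamma> = pt (\<pi> b)"
    "\<pi> b < \<pi> c \<Longrightarrow> \<pi> c < \<pi> a \<Longrightarrow> (c < a \<longrightarrow> passes_right \<gamma> (\<pi> c)) \<and> (b < c \<longrightarrow> passes_left \<gamma> (\<pi> c))"
    using assms(3,4) by (auto simp: delta_class_def)
  have c: "\<pi> c \<in> labels n" using assms by (simp add: permutes_in_image)
  note iff = passes_between[OF \<gamma>(1-3) c]
  have "c < a \<or> c = a \<or> c = b \<or> b < c" "a < b"
    using consecutive_cases[OF assms(2,4)] assms(2) by (simp_all add: consecutive_def)
  then consider "c < a" "\<not> b < c" | "c = a \<or> c = b" | "b < c" "\<not> c < a" by linarith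
  then have "(passes_right \<gamma> (\<pi> c) \<longleftrightarrow> \<pi> b < \<pi> c \<and> \<pi> c < \<pi> a \<and> c < a) \<and>
    (passes_left \<gamma> (\<pi> c) \<longleftrightarrow> \<pi> b < \<pi> c \<and> \<pi> c < \<pi> a \<and> b < c)"
  proof cases
    case 1
    then show ?thesis using iff \<gamma>(4) by blast
  next
    case 2
    then have "\<not> (\<pi> b < \<pi> c \<and> \<pi> c < \<pi> a)" by auto
    then show ?thesis using iff by blast
  next
    case 3
    then show ?thesis using iff \<gamma>(4) by blast
  qed
  then show "passes_right \<gamma> (\<pi> c) \<longleftrightarrow> \<pi> b < \<pi> c \<and> \<pi> c < \<pi> a \<and> c < a"
    "passes_left \<gamma> (\<pi> c) \<longleftrightarrow> \<pi> b < \<pi> c \<and> \<pi> c < \<pi> a \<and> b < c"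
    by blast+
qed

text \<open>Since \<pi> reaches every label, \<open>delta_class_passes\<close> fixes all sides of a
  member, and the members are exactly the curves equivalent to any one of them.\<close>

lemma arc_equiv_class:
  assumes "\<pi> permutes labels n" "consecutive n a b" "\<gamma> \<in> delta_class n \<pi> a b"
  shows "arc_equiv n `` {\<gamma>} = delta_class n \<pi> a b"
proof (intro equalityI subsetI)
  fix \<gamma>' assume "\<gamma>' \<in> arc_equiv n `` {\<gamma>}"
  then have e: "\<gamma>' \<in> arcs n" "pathstart \<gamma> = pathstart \<gamma>'" "pathfinish \<gamma> = pathfinish \<gamma>'"
    "\<And>i. i \<in> labels n \<Longrightarrow> (passes_left \<gamma> i \<longleftrightarrow> passes_left \<gamma>' i) \<and> (passes_right \<gamma> i \<longleftrightarrow> passes_right \<gamma>' i)"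
    by (auto simp: arc_equiv_def)
  have "(passes_left \<gamma>' (\<pi> c) \<longleftrightarrow> passes_left \<gamma> (\<pi> c)) \<and>
      (passes_right \<gamma>' (\<pi> c) \<longleftrightarrow> passes_right \<gamma> (\<pi> c))" if "c \<in> labels n" for c
    using e(4)[of "\<pi> c"] that permutes_in_image[OF assms(1)] by blast
  then show "\<gamma>' \<in> delta_class n \<pi> a b"
    using assms(3) e(1-3) unfolding delta_class_def mem_Collect_eq by metis
next
  fix \<gamma>' assume \<gamma>': "\<gamma>' \<in> delta_class n \<pi> a b"
  have "(passes_left \<gamma> i \<longleftrightarrow> passes_left \<gamma>' i) \<and> (passes_right \<gamma> i \<longleftrightarrow> passes_right \<gamma>' i)"
    if "i \<in> labels n" for i
  proof -
    have "i \<in> \<pi> ` labels n"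
      using that by (simp add: permutes_image[OF assms(1)])
    then obtain c where "c \<in> labels n" "i = \<pi> c" by auto
    then show ?thesis
      using delta_class_passes[OF assms(1,2)] assms(3) \<gamma>' by simp
  qed
  then show "\<gamma>' \<in> arc_equiv n `` {\<gamma>}"
    using assms \<gamma>' by (auto simp: arc_equiv_def delta_class_def)
qed

section \<open>Simultaneous drawing of the arcs of a permutation\<close>

text \<open>A sum of tent functions of radius 1. Distinct integers are at least 1 apart, so at each
  node only its own tent contributes.\<close>

lemma continuous_interpolation_exists:
  fixes A :: "int set" and g :: "int \<Rightarrow> real"
  assumes "finite A"
  obtains s :: "real \<Rightarrow> real" where "continuous_on UNIV s" "\<And>i. i \<in> A \<Longrightarrow> s (of_int i) = g i"
proof
  let ?s = "\<lambda>y. \<Sum>i\<in>A. g i * max 0 (1 - \<bar>y - of_int i\<bar>)"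
  show "continuous_on UNIV ?s"
    by (intro continuous_intros)
  fix i assume i: "i \<in> A"
  have "max 0 (1 - \<bar>real_of_int i - of_int j\<bar>) = (if j = i then 1 else 0)" for j
  proof (cases "j = i")
    case False
    then have "\<bar>i - j\<bar> \<ge> 1" by linarith
    then have "\<bar>real_of_int i - of_int j\<bar> \<ge> 1"
      by (metis of_int_1_le_iff of_int_abs of_int_diff)
    then show ?thesis using False by simp
  qed simp
  then show "?s (of_int i) = g i"
    using assms i by (simp add: mult_delta_right)
qed

lemma compatible_sym: "compatible \<gamma> \<gamma>' \<Longrightarrow> compatible \<gamma>' \<gamma>"
  by (auto simp: compatible_def)

lemma consecutive_disjoint:
  assumes "consecutive n a b" "consecutive n a' b'" "a < a'"
  shows "b \<le> a'" "b < b'"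
  using assms by (fastforce simp: consecutive_def)+

lemma consecutive_unique:
  assumes "consecutive n a b" "consecutive n a b'"
  shows "b = b'"
  using assms by (metis consecutive_def linorder_neqE_linordered_idom)

text \<open>The arcs of a permutation are the descents of its plot, drawn as straight segments: the
  horizontal shear \<open>(x, y) \<mapsto> (x - s y, y)\<close> moves all points of the plot onto the vertical line.\<close>

lemma delta_drawing:
  assumes perm: "\<pi> permutes labels n"
  obtains G where
    "\<And>a b. consecutive n a b \<Longrightarrow> \<pi> b < \<pi> a \<Longrightarrow> G a b \<in> delta_class n \<pi> a b"
    "\<And>a b a' b'. consecutive n a b \<Longrightarrow> \<pi> b < \<pi> a \<Longrightarrow> consecutive n a' b' \<Longrightarrow> \<pi> b' < \<pi> a' \<Longrightarrow>
       a \<noteq> a' \<Longrightarrow> compatible (G a b) (G a' b')"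
proof -
  have inj: "\<pi> i = \<pi> j \<longleftrightarrow> i = j" for i j
    using permutes_inj[OF perm] by (auto dest: injD)
  \<comment> \<open>At the height of label \<open>i\<close> the shear is the position of
    \<open>i\<close> in the word, so the plot point \<open>(c, \<pi> c)\<close> lands on the
    vertical line.\<close>
  obtain s :: "real \<Rightarrow> real" where s: "continuous_on UNIV s"
    "\<And>i. i \<in> labels n \<Longrightarrow> s (of_int i) = of_int (inv \<pi> i)"
    using continuous_interpolation_exists[OF finite_labels[of n], of "\<lambda>i. of_int (inv \<pi> i)"] by blast
  have s\<pi>: "s (of_int (\<pi> c)) = of_int c" if "c \<in> labels n" for c
    using s(2)[of "\<pi> c"] that perm by (simp add: permutes_in_image permutes_inverses)
  define x where "x = (\<lambda>a b t :: real. a + t * (b - a))"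
  define y where "y = (\<lambda>a b. x (of_int (\<pi> a)) (of_int (\<pi> b)))"
  define G where "G = (\<lambda>a b t. Complex (x (of_int a) (of_int b) t - s (y a b t)) (y a b t))"
  have start: "pathstart (G a b) = pt (\<pi> a)" and finish: "pathfinish (G a b) = pt (\<pi> b)"
    if "a \<in> labels n" "b \<in> labels n" for a b
    using that by (simp_all add: G_def x_def y_def pathstart_def pathfinish_def pt_def s\<pi>)
  have mem: "G a b \<in> delta_class n \<pi> a b" if ab: "consecutive n a b" "\<pi> b < \<pi> a" for a b
  proof -
    have lab: "a \<in> labels n" "b \<in> labels n" "a < b" using ab by (auto simp: consecutive_def)
    have path: "path (G a b)"
      unfolding path_def G_def x_def y_def
      by (intro continuous_intros continuous_on_compose2[OF s(1)]) auto
    have anti: "strict_antimono_on {0..1} (\<lambda>t. Im (G a b t))"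
      using ab(2) by (auto simp: monotone_on_def G_def y_def x_def mult_strict_right_mono_neg)
    have at: "\<exists>t. 0 < t \<and> t < 1 \<and> y a b t = of_int (\<pi> c)"
      if "\<pi> b < \<pi> c" "\<pi> c < \<pi> a" for c
    proof (intro exI conjI)
      let ?t = "real_of_int (\<pi> a - \<pi> c) / of_int (\<pi> a - \<pi> b)"
      show "0 < ?t" "?t < 1" using that by simp_all
      have "?t * (of_int (\<pi> b) - of_int (\<pi> a)) = of_int (\<pi> c) - of_int (\<pi> a)"
        using that by (simp add: divide_eq_eq) (simp add: algebra_simps)
      then show "y a b ?t = of_int (\<pi> c)"
        by (simp add: y_def x_def)
    qed
    have passes: "(c < a \<longrightarrow> passes_right (G a b) (\<pi> c)) \<and> (b < c \<longrightarrow> passes_left (G a b) (\<pi> c))"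
      if c: "c \<in> labels n" "\<pi> b < \<pi> c" "\<pi> c < \<pi> a" for c
    proof -
      obtain t where t: "0 < t" "t < 1" "y a b t = of_int (\<pi> c)" using at c by blast
      have d: "0 < real_of_int b - of_int a" using lab(3) by simp
      have "x (of_int a) (of_int b) t > of_int a" "x (of_int a) (of_int b) t < of_int b"
        using mult_pos_pos[OF t(1) d] mult_strict_right_mono[OF t(2) d, unfolded mult_1_left]
        unfolding x_def by (meson less_add_same_cancel1, metis add.commute less_diff_eq)
      moreover have "G a b t \<in> path_image (G a b)" using t by (auto simp: path_image_def)
      moreover have "Re (G a b t) = x (of_int a) (of_int b) t - of_int c" "Im (G a b t) = of_int (\<pi> c)"
        using t s\<pi>[OF c(1)] by (simp_all add: G_def)
      ultimately show ?thesis
        unfolding passes_left_def passes_right_def pt_simps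
        by (smt (verit, best) of_int_less_iff)
    qed
    have "path_image (G a b) \<inter> pt ` (labels n - {\<pi> b, \<pi> a}) = {}"
    proof -
      have "i \<in> {\<pi> b, \<pi> a}" if t: "t \<in> {0..1}" "G a b t = pt i" and i: "i \<in> labels n" for t i
      proof -
        obtain c where c: "c \<in> labels n" "i = \<pi> c"
          using i permutes_image[OF perm] by blast
        have "y a b t = of_int (\<pi> c)" "x (of_int a) (of_int b) t = s (y a b t)"
          using t(2) by (auto simp: G_def pt_def c)
        \<comment> \<open>Undoing the shear, the segment would contain the plot point over position
          \<open>c\<close>; this forces \<open>c\<close> into the range from \<open>a\<close> to
          \<open>b\<close>, whose only positions are its ends.\<close>
        then have "x (of_int a) (of_int b) t = of_int c" using s\<pi>[OF c(1)] by simp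
        moreover have "0 \<le> t * (of_int b - of_int a)" "t * (of_int b - of_int a) \<le> of_int b - of_int a"
          using t lab(3) by (auto intro: mult_left_le_one_le)
        ultimately have "a \<le> c" "c \<le> b" by (simp_all add: x_def)
        then show ?thesis
          using consecutive_cases[OF ab(1) c(1)] c(2) by auto
      qed
      then show ?thesis unfolding path_image_def by blast
    qed
    then have "G a b \<in> arcs n"
      using path anti ab(2) start[OF lab(1,2)] finish[OF lab(1,2)] lab perm
      unfolding arcs_def by (auto simp: permutes_in_image)
    then show ?thesis
      using start[OF lab(1,2)] finish[OF lab(1,2)] passes by (simp add: delta_class_def)
  qed
  have comp: "compatible (G a b) (G a' b')"
    if ab: "consecutive n a b" "consecutive n a' b'" "a < a'" for a b a' b'
  proof -
    have lab: "a \<in> labels n" "b \<in> labels n" "a < b" "a' \<in> labels n" "b' \<in> labels n" "a' < b'"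
      using ab by (auto simp: consecutive_def)
    note d = consecutive_disjoint[OF ab]
    have "z = pt (\<pi> b) \<and> z = pt (\<pi> a')"
      if z: "z \<in> path_image (G a b)" "z \<in> path_image (G a' b')" for z
    proof -
      obtain t t' where t: "0 \<le> t" "t \<le> 1" "z = G a b t" "0 \<le> t'" "t' \<le> 1" "z = G a' b' t'"
        using z by (auto simp: path_image_def)
      \<comment> \<open>Equal heights are sheared by the same amount, so the abscissas already agree
        before the shear.\<close>
      then have eq: "x (of_int a) (of_int b) t = x (of_int a') (of_int b') t'"
        by (auto simp: G_def)
      have le: "x (of_int a) (of_int b) t \<le> of_int b" "of_int a' \<le> x (of_int a') (of_int b') t'"
      proof -
        have "t * (of_int b - of_int a) \<le> of_int b - of_int a"
          using t lab by (intro mult_left_le_one_le) auto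
        then show "x (of_int a) (of_int b) t \<le> of_int b" unfolding x_def by linarith
        show "of_int a' \<le> x (of_int a') (of_int b') t'"
          using t lab by (simp add: x_def)
      qed
      \<comment> \<open>The abscissa ranges of the two unsheared segments have disjoint interiors,
        so a common point lies at the shared end of both.\<close>
      have ba: "b = a'" using d(1) eq le by linarith
      then have "x (of_int a) (of_int b) t = of_int b" "x (of_int a') (of_int b') t' = of_int a'"
        using eq le by linarith+
      then have "(1 - t) * (of_int b - of_int a) = 0"
        by (simp add: x_def algebra_simps)
      then have "t = 1" using lab by simp
      then show ?thesis
        using t(3) finish[OF lab(1,2)] ba by (simp add: pathfinish_def)
    qed
    then show ?thesis
      using d ab(3) lab by (auto simp: compatible_def start finish inj)
  qed
  show ?thesis
    using that[of G] mem comp compatible_sym by (metis linorder_neqE_linordered_idom)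
qed

text \<open>This lets an equality of classes be exploited through a common curve, which determines
  endpoints and sides.\<close>

lemma delta_class_nonempty:
  assumes "\<pi> permutes labels n" "consecutive n a b" "\<pi> b < \<pi> a"
  shows "delta_class n \<pi> a b \<noteq> {}"
  using delta_drawing[OF assms(1)] assms(2,3) by (metis empty_iff)

lemma delta_noncrossing:
  assumes perm: "\<pi> permutes labels n"
  shows "delta n \<pi> \<in> noncrossing_arc_diagrams n"
proof -
  obtain G where G:
    "\<And>a b. consecutive n a b \<Longrightarrow> \<pi> b < \<pi> a \<Longrightarrow> G a b \<in> delta_class n \<pi> a b"
    "\<And>a b a' b'. consecutive n a b \<Longrightarrow> \<pi> b < \<pi> a \<Longrightarrow> consecutive n a' b' \<Longrightarrow> \<pi> b' < \<pi> a' \<Longrightarrow>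
       a \<noteq> a' \<Longrightarrow> compatible (G a b) (G a' b')"
    using delta_drawing[OF perm] by blast
  define C where "C = {G a b | a b. consecutive n a b \<and> \<pi> b < \<pi> a}"
  have "C \<subseteq> arcs n"
    using G(1) by (auto simp: C_def delta_class_def)
  \<comment> \<open>Different curves of \<open>C\<close> have different \<open>a\<close>, because
    \<open>a\<close> determines its successor \<open>b\<close>.\<close>
  moreover have "pairwise compatible C"
    using G(2) consecutive_unique unfolding C_def pairwise_def by blast
  moreover have "delta n \<pi> = C // arc_equiv n"
  proof -
    have "arc_equiv n `` {G a b} = delta_class n \<pi> a b" if "consecutive n a b" "\<pi> b < \<pi> a" for a b
      using arc_equiv_class[OF perm that(1)] G(1) that by blast
    then show ?thesis
      unfolding delta_eq C_def quotient_def by fastforce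
  qed
  ultimately show ?thesis
    unfolding noncrossing_arc_diagrams_def by blast
qed

section \<open>Injectivity via inversions\<close>

text \<open>The least moved element cannot go down, onto a fixed element; if it goes up, its own
  preimage would be a larger element with a smaller image.\<close>

lemma strict_mono_on_finite_eq_id:
  fixes A :: "'a::linorder set"
  assumes "finite A" "strict_mono_on A f" "f ` A = A" "x \<in> A"
  shows "f x = x"
proof (rule ccontr)
  assume "f x \<noteq> x"
  define B where "B = {x \<in> A. f x \<noteq> x}"
  have B: "finite B" "B \<noteq> {}" using assms \<open>f x \<noteq> x\<close> by (auto simp: B_def)
  define m where "m = Min B"
  have "m \<in> B" using B by (simp add: m_def)
  then have m: "m \<in> A" "f m \<noteq> m" by (auto simp: B_def)
  have fixed: "f y = y" if "y \<in> A" "y < m" for y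
    using that B Min_le[of B y] by (force simp: B_def m_def)
  have mono: "f y < f z" if "y \<in> A" "z \<in> A" "y < z" for y z
    using assms(2) that by (simp add: strict_mono_on_def)
  have fm: "f m \<in> A" using assms(3) m(1) by blast
  show False
  proof (cases "f m < m")
    case True
    then show False using fixed[OF fm True] mono[OF fm m(1)] by simp
  next
    case False
    have "m \<in> f ` A" using assms(3) m(1) by simp
    then obtain y where y: "y \<in> A" "m = f y" by (rule imageE)
    have "y \<noteq> m" using m(2) y(2) by metis
    moreover have "\<not> y < m" using fixed[OF y(1)] y(2) by force
    ultimately have "f m < f y" using mono[OF m(1) y(1)] by simp
    then show False using False y(2) by simp
  qed
qed

text \<open>A curve common to the two equal classes has the same endpoints and sides for both
  permutations, and its side at \<open>v\<close> records whether \<open>v\<close> stands before the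
  descent.\<close>

lemma delta_eq_transfer:
  assumes perm: "\<pi> permutes labels n" "\<pi>' permutes labels n"
    and eq: "delta n \<pi> = delta n \<pi>'"
    and ab: "consecutive n a b" "\<pi> b < \<pi> a"
  obtains a' b' where "consecutive n a' b'" "\<pi>' a' = \<pi> a" "\<pi>' b' = \<pi> b"
    "\<And>v. v \<in> labels n \<Longrightarrow> \<pi> b < v \<Longrightarrow> v < \<pi> a \<Longrightarrow> inv \<pi> v < a \<longleftrightarrow> inv \<pi>' v < a'"
proof -
  have "delta_class n \<pi> a b \<in> delta n \<pi>"
    using ab unfolding delta_eq by blast
  then have "delta_class n \<pi> a b \<in> delta n \<pi>'" using eq by simp
  then obtain a' b' where ab': "consecutive n a' b'" "delta_class n \<pi> a b = delta_class n \<pi>' a' b'"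
    unfolding delta_eq by blast
  obtain \<gamma> where \<gamma>: "\<gamma> \<in> delta_class n \<pi> a b" "\<gamma> \<in> delta_class n \<pi>' a' b'"
    using delta_class_nonempty[OF perm(1) ab] ab'(2) by blast
  have ends: "\<pi>' a' = \<pi> a" "\<pi>' b' = \<pi> b"
    using \<gamma> by (auto simp: delta_class_def)
  have "inv \<pi> v < a \<longleftrightarrow> inv \<pi>' v < a'" if v: "v \<in> labels n" "\<pi> b < v" "v < \<pi> a" for v
  proof -
    have "\<pi> (inv \<pi> v) = v" "\<pi>' (inv \<pi>' v) = v" "inv \<pi> v \<in> labels n" "inv \<pi>' v \<in> labels n"
      using perm v(1) by (simp_all add: permutes_inverses permutes_in_image[OF permutes_inv])
    then show ?thesis
      using delta_class_passes(1)[OF perm(1) ab(1) \<gamma>(1), of "inv \<pi> v"]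
        delta_class_passes(1)[OF perm(2) ab'(1) \<gamma>(2), of "inv \<pi>' v"] v ends by simp
  qed
  then show ?thesis using that ab'(1) ends by blast
qed

text \<open>An intermediate value standing between \<open>v\<close> and \<open>u\<close> reduces the
  claim to two smaller differences by transitivity. Otherwise the positions between them carry only
  values at most \<open>u\<close> or at least \<open>v\<close>, so some descent jumps over the whole
  range from \<open>v\<close> to \<open>u\<close>, and its arc is shared by both
  permutations.\<close>

lemma inversion_step:
  assumes perm: "\<pi> permutes labels n" "\<pi>' permutes labels n"
    and eq: "delta n \<pi> = delta n \<pi>'"
    and uv: "u \<in> labels n" "v \<in> labels n" "u < v"
    and IH: "\<And>w. w \<in> labels n \<Longrightarrow> u < w \<Longrightarrow> w < v \<Longrightarrow>
      (inv \<pi> w < inv \<pi> u \<longleftrightarrow> inv \<pi>' w < inv \<pi>' u) \<and> (inv \<pi> v < inv \<pi> w \<longleftrightarrow> inv \<pi>' v < inv \<pi>' w)"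
    and less: "inv \<pi> v < inv \<pi> u"
  shows "inv \<pi>' v < inv \<pi>' u"
proof (cases "\<exists>w\<in>labels n. u < w \<and> w < v \<and> inv \<pi> v < inv \<pi> w \<and> inv \<pi> w < inv \<pi> u")
  case True
  then show ?thesis using IH by (meson less_trans)
next
  case False
  define k l where "k = inv \<pi> v" and "l = inv \<pi> u"
  have kl: "k \<in> labels n" "l \<in> labels n" "\<pi> k = v" "\<pi> l = u" "k < l"
    using perm uv less by (simp_all add: k_def l_def permutes_inverses permutes_in_image[OF permutes_inv])
  have inv\<pi>: "inv \<pi> (\<pi> c) = c" and inv\<pi>': "inv \<pi>' (\<pi>' c) = c" for c
    using perm by (simp_all add: permutes_inverses)
  have none: "\<pi> c \<le> u \<or> v \<le> \<pi> c" if "c \<in> labels n" "k < c" "c < l" for c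
    using False that permutes_in_image[OF perm(1), of c]
    by (metis inv\<pi> k_def l_def not_le)
  \<comment> \<open>The last position before \<open>l\<close> with a value at least \<open>v\<close>
    is the upper end of the required descent; \<open>k\<close> itself ensures that one
    exists.\<close>
  define S where "S = {c \<in> labels n. k \<le> c \<and> c < l \<and> v \<le> \<pi> c}"
  have S: "finite S" "k \<in> S" using kl by (auto simp: S_def)
  define a where "a = Max S"
  have "a \<in> S" using S by (auto simp: a_def intro: Max_in)
  then have a: "a \<in> labels n" "k \<le> a" "a < l" "v \<le> \<pi> a" by (auto simp: S_def)
  define R where "R = {c \<in> labels n. a < c}"
  have R: "finite R" "l \<in> R" using kl a by (auto simp: R_def)
  define b where "b = Min R"
  have "b \<in> R" using R by (auto simp: b_def intro: Min_in)
  then have b: "b \<in> labels n" "a < b" by (auto simp: R_def)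
  have bl: "b \<le> l" using R by (simp add: b_def)
  have cons: "consecutive n a b"
  proof -
    have "b \<le> c" if "c \<in> labels n" "a < c" for c
      using that R(1) by (simp add: b_def R_def)
    then show ?thesis using a b by (simp add: consecutive_def) (meson not_le)
  qed
  have "b \<notin> S" using Max_ge[OF S(1), of b] b(2) by (auto simp: a_def)
  then have "\<pi> b \<le> u"
    using none[of b] b bl a kl by (cases "b = l") (auto simp: S_def)
  then have desc: "\<pi> b < \<pi> a" using a uv by linarith
  obtain a' b' where ab': "consecutive n a' b'" "\<pi>' a' = \<pi> a" "\<pi>' b' = \<pi> b"
    "\<And>w. w \<in> labels n \<Longrightarrow> \<pi> b < w \<Longrightarrow> w < \<pi> a \<Longrightarrow> inv \<pi> w < a \<longleftrightarrow> inv \<pi>' w < a'"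
    using delta_eq_transfer[OF perm eq cons desc] by blast
  \<comment> \<open>The label \<open>v\<close> is either the upper endpoint of the shared arc or
    strictly inside it, to be located by its side; likewise \<open>u\<close> with the lower
    endpoint.\<close>
  have "inv \<pi>' v \<le> a'"
  proof (cases "v = \<pi> a")
    case True
    then show ?thesis using ab'(2) inv\<pi>' by (metis order_refl)
  next
    case False
    then have "k < a" using a(2) kl(3) by (cases "k = a") auto
    then show ?thesis using ab'(4)[OF uv(2)] \<open>\<pi> b \<le> u\<close> uv(3) a(4) False by (simp add: k_def)
  qed
  moreover have "a' < inv \<pi>' u"
  proof (cases "u = \<pi> b")
    case True
    then show ?thesis using ab'(1,3) inv\<pi>' by (metis consecutive_def)
  next
    case False
    then have "\<not> inv \<pi>' u < a'"
      using ab'(4)[OF uv(1)] \<open>\<pi> b \<le> u\<close> uv(3) a bl b by (simp add: l_def)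
    moreover have "inv \<pi>' u \<noteq> a'"
      using ab'(2) perm(2) a(4) uv(3) by (metis permutes_inverses(1) leD)
    ultimately show ?thesis by simp
  qed
  ultimately show ?thesis by simp
qed

text \<open>Equal inversions make \<open>inv \<pi>' \<circ> \<pi>\<close> increasing on the finite
  set of positions, hence the identity there.\<close>

lemma delta_inj:
  assumes perm: "\<pi> permutes labels n" "\<pi>' permutes labels n"
    and eq: "delta n \<pi> = delta n \<pi>'"
  shows "\<pi> = \<pi>'"
proof -
  have inv: "inv \<pi> v < inv \<pi> u \<longleftrightarrow> inv \<pi>' v < inv \<pi>' u"
    if "u \<in> labels n" "v \<in> labels n" "u < v" for u v
    using that
  proof (induction "nat (v - u)" arbitrary: u v rule: less_induct)
    case less
    have IH: "(inv \<pi> w < inv \<pi> u \<longleftrightarrow> inv \<pi>' w < inv \<pi>' u) \<and> (inv \<pi> v < inv \<pi> w \<longleftrightarrow> inv \<pi>' v < inv \<pi>' w)"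
      if "w \<in> labels n" "u < w" "w < v" for w
      using less.hyps[of w u] less.hyps[of v w] less.prems that by auto
    show ?case
      using inversion_step[OF perm eq less.prems] inversion_step[OF perm(2,1) eq[symmetric] less.prems] IH
      by blast
  qed
  have im: "(inv \<pi>' \<circ> \<pi>) ` labels n = labels n"
    by (rule permutes_image[OF permutes_compose[OF perm(1) permutes_inv[OF perm(2)]]])
  have mono: "strict_mono_on (labels n) (inv \<pi>' \<circ> \<pi>)"
  proof (rule strict_mono_onI)
    fix i j assume ij: "i \<in> labels n" "j \<in> labels n" "i < j"
    have lab: "\<pi> i \<in> labels n" "\<pi> j \<in> labels n" using ij perm by (simp_all add: permutes_in_image)
    have inv\<pi>: "inv \<pi> (\<pi> i) = i" "inv \<pi> (\<pi> j) = j" using perm by (simp_all add: permutes_inverses)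
    have ne: "\<pi> i \<noteq> \<pi> j" using inv\<pi> ij by auto
    then have ne': "inv \<pi>' (\<pi> i) \<noteq> inv \<pi>' (\<pi> j)"
      using perm(2) by (metis permutes_inverses(1))
    have "inv \<pi>' (\<pi> i) < inv \<pi>' (\<pi> j)"
      using inv[OF lab] inv[OF lab(2,1)] ne ne' ij(3) unfolding inv\<pi>
      by (cases "\<pi> i < \<pi> j") auto
    then show "(inv \<pi>' \<circ> \<pi>) i < (inv \<pi>' \<circ> \<pi>) j" by simp
  qed
  have "\<pi> i = \<pi>' i" if "i \<in> labels n" for i
    using strict_mono_on_finite_eq_id[OF finite_labels mono im that] perm(2)
    by (metis comp_apply permutes_inverses(1))
  then show ?thesis
    using perm by (metis permutes_not_in ext)
qed

section \<open>Every noncrossing arc diagram comes from a permutation\<close>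

text \<open>Applied to the difference of the abscissas of two arcs, it shows that they keep their
  left-to-right order.\<close>

lemma continuous_nonzero_neg:
  fixes d :: "real \<Rightarrow> real"
  assumes "continuous_on {m..M} d" "\<And>y. y \<in> {m..M} \<Longrightarrow> d y \<noteq> 0"
    and "x \<in> {m..M}" "y \<in> {m..M}" "d x < 0"
  shows "d y < 0"
proof (rule ccontr)
  assume "\<not> d y < 0"
  moreover have "connected (d ` {m..M})"
    using assms(1) by (intro connected_continuous_image) auto
  ultimately have "0 \<in> d ` {m..M}"
    using assms(3-5) connectedD_interval[of "d ` {m..M}" "d x" "d y" 0] by auto
  then show False using assms(2) by auto
qed

text \<open>Compatibility leaves one curve of \<open>C\<close> for each upper endpoint. Their graphs
  over the height form an instance of \<open>sweep\<close>, and the sides obtained there identify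
  the classes.\<close>

lemma noncrossing_is_delta:
  assumes "D \<in> noncrossing_arc_diagrams n"
  obtains \<pi> where "\<pi> permutes labels n" "delta n \<pi> = D"
proof -
  obtain C where C: "C \<subseteq> arcs n" "pairwise compatible C" "D = C // arc_equiv n"
    using assms by (auto simp: noncrossing_arc_diagrams_def)
  define T where "T = {q \<in> labels n. \<exists>\<gamma>\<in>C. pathstart \<gamma> = pt q}"
  \<comment> \<open>Bundling these facts into one predicate allows the curve, its lower endpoint and
    its graph to be chosen together for each upper endpoint.\<close>
  define arc_data where "arc_data = (\<lambda>q \<gamma> p (X :: real \<Rightarrow> real).
    \<gamma> \<in> C \<and> p \<in> labels n \<and> p < q \<and> pathstart \<gamma> = pt q \<and> pathfinish \<gamma> = pt p \<and>
    continuous_on {of_int p..of_int q} X \<and>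
    path_image \<gamma> = (\<lambda>y. Complex (X y) y) ` {of_int p..of_int q} \<and>
    X p = 0 \<and> X q = 0 \<and> (\<forall>i. i \<in> labels n \<longrightarrow> p < i \<longrightarrow> i < q \<longrightarrow> X i \<noteq> 0))"
  have "\<exists>\<gamma> p X. arc_data q \<gamma> p X" if q: "q \<in> T" for q
  proof -
    obtain \<gamma> where \<gamma>: "\<gamma> \<in> C" "pathstart \<gamma> = pt q" using q by (auto simp: T_def)
    with C(1) have "\<gamma> \<in> arcs n" by blast
    then show ?thesis
    proof (rule arcsE, goal_cases)
      case (1 p q' X)
      then have "q' = q" using \<gamma>(2) by simp
      with 1 \<gamma>(1) have "arc_data q \<gamma> p X" by (simp add: arc_data_def)
      then show ?case by blast
    qed
  qed
  then obtain \<Gamma> B F where "\<And>q. q \<in> T \<Longrightarrow> arc_data q (\<Gamma> q) (B q) (F q)"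
    by metis
  note \<Gamma> = this[unfolded arc_data_def]
  have compat: "compatible (\<Gamma> q) (\<Gamma> r)" if "q \<in> T" "r \<in> T" "q \<noteq> r" for q r
  proof -
    have "\<Gamma> q \<noteq> \<Gamma> r" using \<Gamma>[OF that(1)] \<Gamma>[OF that(2)] that(3) by (metis pt_simps(3))
    then show ?thesis using C(2) \<Gamma> that by (auto simp: pairwise_def)
  qed
  have C_eq: "C = \<Gamma> ` T"
  proof
    show "\<Gamma> ` T \<subseteq> C" using \<Gamma> by blast
    show "C \<subseteq> \<Gamma> ` T"
    proof
      fix \<gamma> assume \<gamma>: "\<gamma> \<in> C"
      then obtain q where q: "q \<in> labels n" "pathstart \<gamma> = pt q"
        using C(1) by (auto simp: arcs_def)
      then have qT: "q \<in> T" using \<gamma> by (auto simp: T_def)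
      have "\<gamma> = \<Gamma> q"
      proof (rule ccontr)
        assume "\<gamma> \<noteq> \<Gamma> q"
        then have "compatible \<gamma> (\<Gamma> q)" using C(2) \<gamma> \<Gamma>[OF qT] by (simp add: pairwise_def)
        then show False using q \<Gamma>[OF qT] by (simp add: compatible_def)
      qed
      then show "\<gamma> \<in> \<Gamma> ` T" using qT by blast
    qed
  qed
  \<comment> \<open>A meeting point must be an endpoint of both arcs. When the height ranges overlap
    in more than one height, it would be a shared top or a shared bottom, which compatibility
    forbids; chained arcs, which may touch, are excluded by the strict inequality.\<close>
  have distinct: "F q y \<noteq> F r y"
    if qr: "q \<in> T" "r \<in> T" "q \<noteq> r" "max (B q) (B r) < min q r"
      and y: "of_int (max (B q) (B r)) \<le> y" "y \<le> of_int (min q r)" for q r y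
  proof
    assume eq: "F q y = F r y"
    have "y \<in> {of_int (B q)..of_int q}" "y \<in> {of_int (B r)..of_int r}" using y by auto
    then have "Complex (F q y) y \<in> path_image (\<Gamma> q)" "Complex (F r y) y \<in> path_image (\<Gamma> r)"
      using \<Gamma>[OF qr(1)] \<Gamma>[OF qr(2)] by blast+
    then have "Complex (F q y) y \<in> path_image (\<Gamma> q) \<inter> path_image (\<Gamma> r)"
      by (simp add: eq)
    moreover have "path_image (\<Gamma> q) \<inter> path_image (\<Gamma> r) \<subseteq> {pt q, pt (B q)} \<inter> {pt r, pt (B r)}"
      using compat[OF qr(1-3)] \<Gamma>[OF qr(1)] \<Gamma>[OF qr(2)] by (simp add: compatible_def)
    ultimately have "Complex (F q y) y \<in> {pt q, pt (B q)} \<inter> {pt r, pt (B r)}" by blast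
    then have "(y = of_int q \<or> y = of_int (B q)) \<and> (y = of_int r \<or> y = of_int (B r))"
      by (auto simp: pt_def)
    moreover have "B q \<noteq> B r"
      using compat[OF qr(1-3)] \<Gamma>[OF qr(1)] \<Gamma>[OF qr(2)] unfolding compatible_def by metis
    ultimately show False using qr(3,4) by auto
  qed
  interpret sweep "labels n" T B "\<lambda>q h. F q (of_int h)"
  proof unfold_locales
    show "finite (labels n)" by simp
    show "T \<subseteq> labels n" by (auto simp: T_def)
    show "inj_on B T"
    proof (rule inj_onI, rule ccontr)
      fix q r assume qr: "q \<in> T" "r \<in> T" "B q = B r" "q \<noteq> r"
      then show False
        using compat[OF qr(1,2,4)] \<Gamma>[OF qr(1)] \<Gamma>[OF qr(2)] by (simp add: compatible_def)
    qed
    show "F q (of_int h) \<noteq> F r (of_int h)"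
      if "q \<in> T" "r \<in> T" "q \<noteq> r" "max (B q) (B r) \<le> h" "h \<le> min q r" "max (B q) (B r) < min q r" for q r h
      using distinct[OF that(1-3,6), of "of_int h"] that(4,5) by simp
    show "F q (of_int h') < F r (of_int h')"
      if qr: "q \<in> T" "r \<in> T" "q \<noteq> r" and h: "max (B q) (B r) \<le> h" "h \<le> min q r"
        "max (B q) (B r) \<le> h'" "h' \<le> min q r" and less: "max (B q) (B r) < min q r"
        "F q (of_int h) < F r (of_int h)" for q r h h'
    proof -
      let ?m = "real_of_int (max (B q) (B r))" and ?M = "real_of_int (min q r)"
      have "continuous_on {?m..?M} (F q)" "continuous_on {?m..?M} (F r)"
        using \<Gamma>[OF qr(1)] \<Gamma>[OF qr(2)] by (auto elim!: continuous_on_subset)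
      then have "continuous_on {?m..?M} (\<lambda>y. F q y - F r y)"
        by (intro continuous_intros)
      moreover have "F q y - F r y \<noteq> 0" if "y \<in> {?m..?M}" for y
        using distinct[OF qr less(1), of y] that by auto
      moreover have "real_of_int h \<in> {?m..?M}" "real_of_int h' \<in> {?m..?M}" using h by auto
      ultimately have "F q (of_int h') - F r (of_int h') < 0"
        using continuous_nonzero_neg[of ?m ?M "\<lambda>y. F q y - F r y" "of_int h" "of_int h'"] less(2) by auto
      then show ?thesis by simp
    qed
  qed (use \<Gamma> in auto)
  obtain \<pi> where perm: "\<pi> permutes labels n"
    and desc: "\<And>a b. consecutive n a b \<Longrightarrow> \<pi> b < \<pi> a \<longleftrightarrow> \<pi> a \<in> T \<and> B (\<pi> a) = \<pi> b"
    and arc: "\<And>q. q \<in> T \<Longrightarrow> \<exists>a b. consecutive n a b \<and> \<pi> a = q \<and> \<pi> b = B q"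
    and side: "\<And>a c. a \<in> labels n \<Longrightarrow> c \<in> labels n \<Longrightarrow> \<pi> a \<in> T \<Longrightarrow> B (\<pi> a) < \<pi> c \<Longrightarrow> \<pi> c < \<pi> a \<Longrightarrow>
       (if c < a then F (\<pi> a) (\<pi> c) > 0 else F (\<pi> a) (\<pi> c) < 0)"
    by (rule permutation_exists[OF refl]) (rule that)
  have cls: "arc_equiv n `` {\<Gamma> (\<pi> a)} = delta_class n \<pi> a b"
    if ab: "consecutive n a b" "\<pi> a \<in> T" "\<pi> b = B (\<pi> a)" for a b
  proof -
    note G = \<Gamma>[OF ab(2)]
    have "(c < a \<longrightarrow> passes_right (\<Gamma> (\<pi> a)) (\<pi> c)) \<and> (b < c \<longrightarrow> passes_left (\<Gamma> (\<pi> a)) (\<pi> c))"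
      if c: "c \<in> labels n" "\<pi> b < \<pi> c" "\<pi> c < \<pi> a" for c
    proof -
      have "passes_left (\<Gamma> (\<pi> a)) (\<pi> c) \<longleftrightarrow> F (\<pi> a) (\<pi> c) < 0"
        "passes_right (\<Gamma> (\<pi> a)) (\<pi> c) \<longleftrightarrow> F (\<pi> a) (\<pi> c) > 0"
        using passes_graph[of "\<Gamma> (\<pi> a)" "F (\<pi> a)" "B (\<pi> a)" "\<pi> a" "\<pi> c"] G c ab(3) by auto
      then show ?thesis
        using side[of a c] ab c by (auto simp: consecutive_def split: if_splits)
    qed
    then have "\<Gamma> (\<pi> a) \<in> delta_class n \<pi> a b"
      using G C(1) ab(3) by (auto simp: delta_class_def)
    then show ?thesis by (rule arc_equiv_class[OF perm ab(1)])
  qed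
  have "delta n \<pi> = D"
  proof
    show "delta n \<pi> \<subseteq> D"
    proof
      fix A assume "A \<in> delta n \<pi>"
      then obtain a b where ab: "consecutive n a b" "\<pi> b < \<pi> a" "A = delta_class n \<pi> a b"
        unfolding delta_eq by blast
      then have T: "\<pi> a \<in> T" "\<pi> b = B (\<pi> a)" using desc by auto
      then have "arc_equiv n `` {\<Gamma> (\<pi> a)} \<in> D"
        using \<Gamma> unfolding C(3) by (intro quotientI) blast
      then show "A \<in> D" using cls[OF ab(1) T] ab(3) by simp
    qed
    show "D \<subseteq> delta n \<pi>"
    proof
      fix A assume "A \<in> D"
      then obtain q where q: "q \<in> T" "A = arc_equiv n `` {\<Gamma> q}"
        unfolding C(3) C_eq by (auto elim: quotientE)
      then obtain a b where ab: "consecutive n a b" "\<pi> a = q" "\<pi> b = B q" using arc by blast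
      then have "\<pi> b < \<pi> a" "A = delta_class n \<pi> a b"
        using q desc[OF ab(1)] cls[OF ab(1)] by auto
      then show "A \<in> delta n \<pi>" using ab(1) unfolding delta_eq by blast
    qed
  qed
  with perm show ?thesis by (rule that)
qed

section \<open>Half-turns of diagrams and of permutations\<close>

lemma half_turn_half_turn [simp]: "half_turn (half_turn \<gamma>) = \<gamma>"
  by (simp add: half_turn_def reversepath_def)

lemma pathstart_half_turn [simp]: "pathstart (half_turn \<gamma>) = - pathfinish \<gamma>"
  and pathfinish_half_turn [simp]: "pathfinish (half_turn \<gamma>) = - pathstart \<gamma>"
  by (simp_all add: half_turn_def reversepath_def pathstart_def pathfinish_def)

lemma path_image_half_turn: "path_image (half_turn \<gamma>) = uminus ` path_image \<gamma>"
  unfolding half_turn_def path_image_reversepath by (simp add: path_image_def image_image)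

lemma passes_half_turn:
  "passes_left (half_turn \<gamma>) i \<longleftrightarrow> passes_right \<gamma> (- i)"
  "passes_right (half_turn \<gamma>) i \<longleftrightarrow> passes_left \<gamma> (- i)"
proof -
  have "- x = y \<longleftrightarrow> x = - y" for x y :: real by auto
  then show "passes_left (half_turn \<gamma>) i \<longleftrightarrow> passes_right \<gamma> (- i)"
    "passes_right (half_turn \<gamma>) i \<longleftrightarrow> passes_left \<gamma> (- i)"
    by (simp_all add: passes_left_def passes_right_def path_image_half_turn)
qed

lemma half_turn_arcs:
  assumes "\<gamma> \<in> arcs n"
  shows "half_turn \<gamma> \<in> arcs n"
proof -
  obtain q p where \<gamma>: "path \<gamma>" "strict_antimono_on {0..1} (\<lambda>t. Im (\<gamma> t))"
    "q \<in> labels n" "p \<in> labels n" "p < q" "pathstart \<gamma> = pt q" "pathfinish \<gamma> = pt p"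
    "path_image \<gamma> \<inter> pt ` (labels n - {p, q}) = {}"
    using assms by (auto simp: arcs_def)
  have "path (\<lambda>t. - \<gamma> t)"
    using \<gamma>(1) unfolding path_def by (rule continuous_on_minus)
  then have "path (half_turn \<gamma>)" by (simp add: half_turn_def)
  moreover have "strict_antimono_on {0..1} (\<lambda>t. Im (half_turn \<gamma> t))"
    using \<gamma>(2) by (auto simp: monotone_on_def half_turn_def reversepath_def)
  moreover have "path_image (half_turn \<gamma>) \<inter> pt ` (labels n - {- q, - p}) = {}"
  proof -
    have "i = - q \<or> i = - p" if "pt i \<in> uminus ` path_image \<gamma>" "i \<in> labels n" for i
    proof -
      have "pt (- i) \<in> path_image \<gamma>" using that(1) by auto
      then have "- i = p \<or> - i = q" using \<gamma>(8) that(2) uminus_labels_iff by blast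
      then show ?thesis by auto
    qed
    then have "pt i \<notin> path_image (half_turn \<gamma>)" if "i \<in> labels n - {- q, - p}" for i
      using that unfolding path_image_half_turn by (metis Diff_iff insertCI)
    then show ?thesis by auto
  qed
  ultimately show ?thesis
    using \<gamma>(3-7) unfolding arcs_def mem_Collect_eq
    by (intro conjI bexI[of _ "- p"] bexI[of _ "- q"]) simp_all
qed

text \<open>The plot of \<open>rotated \<pi>\<close> is the plot of \<pi> turned by 180 degrees
  about the origin.\<close>

definition rotated :: "(int \<Rightarrow> int) \<Rightarrow> int \<Rightarrow> int" where
  "rotated \<pi> = (\<lambda>i. - \<pi> (- i))"

lemma rotated_rotated [simp]: "rotated (rotated \<pi>) = \<pi>"
  by (simp add: rotated_def)

lemma rotated_permutes:
  assumes "\<pi> permutes labels n"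
  shows "rotated \<pi> permutes labels n"
proof -
  have "bij_betw uminus (labels n) (labels n)"
    by (rule bij_betwI[of _ _ _ uminus]) auto
  moreover have "bij_betw \<pi> (labels n) (labels n)"
    using assms by (rule permutes_imp_bij)
  ultimately have "bij_betw (uminus \<circ> (\<pi> \<circ> uminus)) (labels n) (labels n)"
    by (blast intro: bij_betw_trans)
  moreover have "uminus \<circ> (\<pi> \<circ> uminus) = rotated \<pi>" by (auto simp: rotated_def)
  ultimately show ?thesis
    using permutes_not_in[OF assms] by (intro bij_imp_permutes) (auto simp: rotated_def)
qed

text \<open>The sign condition on labels extends to all integers because \<pi> is the identity off
  the labels.\<close>

lemma signed_permutations_rotated:
  "\<pi> \<in> signed_permutations n \<longleftrightarrow> \<pi> permutes labels n \<and> rotated \<pi> = \<pi>"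
proof -
  have "rotated \<pi> = \<pi> \<longleftrightarrow> (\<forall>i\<in>labels n. \<pi> (- i) = - \<pi> i)" if perm: "\<pi> permutes labels n"
  proof
    show "\<forall>i\<in>labels n. \<pi> (- i) = - \<pi> i" if "rotated \<pi> = \<pi>"
      by (metis that rotated_def minus_minus)
    assume *: "\<forall>i\<in>labels n. \<pi> (- i) = - \<pi> i"
    show "rotated \<pi> = \<pi>"
    proof
      show "rotated \<pi> i = \<pi> i" for i
        using * permutes_not_in[OF perm, of i] permutes_not_in[OF perm, of "- i"]
        by (cases "i \<in> labels n") (auto simp: rotated_def)
    qed
  qed
  then show ?thesis by (auto simp: signed_permutations_def)
qed

lemma consecutive_uminus: "consecutive n (- b) (- a) \<longleftrightarrow> consecutive n a b"
proof -
  have "(\<forall>c\<in>labels n. \<not> (- b < c \<and> c < - a)) \<longleftrightarrow> (\<forall>c\<in>labels n. \<not> (a < c \<and> c < b))"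
  proof (intro iffI ballI)
    show "\<not> (a < c \<and> c < b)" if "\<forall>c\<in>labels n. \<not> (- b < c \<and> c < - a)" "c \<in> labels n" for c
      using bspec[OF that(1), of "- c"] that(2) by auto
    show "\<not> (- b < c \<and> c < - a)" if "\<forall>c\<in>labels n. \<not> (a < c \<and> c < b)" "c \<in> labels n" for c
      using bspec[OF that(1), of "- c"] that(2) by auto
  qed
  then show ?thesis by (auto simp: consecutive_def)
qed

text \<open>The half-turn exchanges upper with lower endpoint, left with right and before with
  after, so the defining conditions carry over with \<open>a\<close> and \<open>b\<close> swapped
  and negated.\<close>

lemma half_turn_delta_class:
  assumes "\<gamma> \<in> delta_class n \<pi> a b"
  shows "half_turn \<gamma> \<in> delta_class n (rotated \<pi>) (- b) (- a)"
proof -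
  have \<gamma>: "\<gamma> \<in> arcs n" "pathstart \<gamma> = pt (\<pi> a)" "pathfinish \<gamma> = pt (\<pi> b)"
    "\<And>c. c \<in> labels n \<Longrightarrow> \<pi> b < \<pi> c \<Longrightarrow> \<pi> c < \<pi> a \<Longrightarrow>
       (c < a \<longrightarrow> passes_right \<gamma> (\<pi> c)) \<and> (b < c \<longrightarrow> passes_left \<gamma> (\<pi> c))"
    using assms by (auto simp: delta_class_def)
  have "(c < - b \<longrightarrow> passes_right (half_turn \<gamma>) (rotated \<pi> c)) \<and>
      (- a < c \<longrightarrow> passes_left (half_turn \<gamma>) (rotated \<pi> c))"
    if "c \<in> labels n" "rotated \<pi> (- a) < rotated \<pi> c" "rotated \<pi> c < rotated \<pi> (- b)" for c
    using \<gamma>(4)[of "- c"] that by (auto simp: rotated_def passes_half_turn)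
  then show ?thesis
    using \<gamma>(1-3) by (simp add: delta_class_def half_turn_arcs rotated_def)
qed

lemma image_half_turn_delta_class:
  "half_turn ` delta_class n \<pi> a b = delta_class n (rotated \<pi>) (- b) (- a)"
proof
  show "half_turn ` delta_class n \<pi> a b \<subseteq> delta_class n (rotated \<pi>) (- b) (- a)"
    using half_turn_delta_class by blast
  show "delta_class n (rotated \<pi>) (- b) (- a) \<subseteq> half_turn ` delta_class n \<pi> a b"
  proof
    fix \<gamma> assume "\<gamma> \<in> delta_class n (rotated \<pi>) (- b) (- a)"
    then have "half_turn \<gamma> \<in> delta_class n \<pi> a b"
      using half_turn_delta_class[of \<gamma> n "rotated \<pi>" "- b" "- a"] by simp
    then show "\<gamma> \<in> half_turn ` delta_class n \<pi> a b"
      by (metis half_turn_half_turn imageI)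
  qed
qed

lemma half_turn_delta: "(\<lambda>A. half_turn ` A) ` delta n \<pi> = delta n (rotated \<pi>)"
proof -
  \<comment> \<open>Stated for every \<pi>, so that applying it to \<open>rotated \<pi>\<close>
    gives the reverse inclusion by involution.\<close>
  have sub: "half_turn ` A \<in> delta n (rotated \<pi>)" if A: "A \<in> delta n \<pi>" for A and \<pi> :: "int \<Rightarrow> int"
  proof -
    obtain a b where ab: "consecutive n a b" "\<pi> b < \<pi> a" "A = delta_class n \<pi> a b"
      using A unfolding delta_eq by blast
    then have "consecutive n (- b) (- a)" "rotated \<pi> (- a) < rotated \<pi> (- b)"
      by (simp_all add: consecutive_uminus rotated_def)
    then show ?thesis
      unfolding ab(3) image_half_turn_delta_class delta_eq by blast
  qed
  have "A \<in> (\<lambda>A. half_turn ` A) ` delta n \<pi>" if "A \<in> delta n (rotated \<pi>)" for A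
    using sub[OF that] by (intro image_eqI[of _ _ "half_turn ` A"]) (simp_all add: image_image)
  then show ?thesis using sub by blast
qed

theorem theorem4p1:
  fixes n :: nat
  shows "bij_betw (delta n) (signed_permutations n)
           {D \<in> noncrossing_arc_diagrams n. centrally_symmetric D}"
proof (rule bij_betw_imageI)
  show "inj_on (delta n) (signed_permutations n)"
    by (auto simp: inj_on_def signed_permutations_rotated intro: delta_inj)
  show "delta n ` signed_permutations n = {D \<in> noncrossing_arc_diagrams n. centrally_symmetric D}"
  proof (intro equalityI subsetI)
    fix D assume "D \<in> delta n ` signed_permutations n"
    then obtain \<pi> where \<pi>: "\<pi> permutes labels n" "rotated \<pi> = \<pi>" "D = delta n \<pi>"
      by (auto simp: signed_permutations_rotated)
    have "centrally_symmetric D"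
      unfolding centrally_symmetric_def \<pi>(3) half_turn_delta \<pi>(2) ..
    then show "D \<in> {D \<in> noncrossing_arc_diagrams n. centrally_symmetric D}"
      using delta_noncrossing[OF \<pi>(1)] \<pi>(3) by simp
  next
    fix D assume D: "D \<in> {D \<in> noncrossing_arc_diagrams n. centrally_symmetric D}"
    then obtain \<pi> where \<pi>: "\<pi> permutes labels n" "delta n \<pi> = D"
      using noncrossing_is_delta by blast
    \<comment> \<open>Central symmetry of \<open>D\<close> is read through
      \<open>half_turn_delta\<close>, so that \<open>delta_inj\<close> can force \<pi> to be
      signed.\<close>
    have "delta n (rotated \<pi>) = delta n \<pi>"
      using D unfolding half_turn_delta[symmetric] \<pi>(2) by (simp add: centrally_symmetric_def)
    then have "rotated \<pi> = \<pi>"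
      using delta_inj \<pi>(1) rotated_permutes by blast
    then show "D \<in> delta n ` signed_permutations n"
      using \<pi> by (auto simp: signed_permutations_rotated)
  qed
qed

end
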